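(* Let $(W,S)$ be a Coxeter system, let $t\in T$ and let $\alpha_t\in\Phi^+$ be the corresponding positive root. (1) Let $r,s_1,\dots,s_k\in S$ be such that $\alpha_r\lhd s_k(\alpha_r)\lhd\cdots\lhd s_1\cdots s_{k-1}s_k(\alpha_r)=\alpha_t$ is a saturated chain in the root poset $(\Phi^+,\le)$. Then $s_1\cdots s_k r$ is a reduced word for some $t$-prefix $p_t$. (2) Let $p_t$ be a $t$-prefix and fix a reduced word $p_t=s_1\cdots s_kr$, where $r$ is the unique right descent of $p_t$. Then $\alpha_r\lhd s_k(\alpha_r)\lhd\cdots\lhd s_1\cdots s_{k-1}s_k(\alpha_r)=\alpha_t$ is a saturated chain in $(\Phi^+,\le)$.
   Context: $(W,S)$ is a Coxeter system with $S$ finite, length function $\ell$, and set of reflections $T=\bigcup_{w\in W}wSw^{-1}$. A right descent of $w$ is an $s\in S$ with $\ell(ws)<\ell(w)$. Geometric representation: $V$ is a finite-dimensional real vector space with a symmetric bilinear form $B$, and $\Delta=\{\alpha_s\mid s\in S\}\subset V$ is such that: if $\sum a_s\alpha_s=0$ with all $a_s\ge 0$ then all $a_s=0$; $B(\alpha_s,\alpha_s)=1$; for $s\ne t$, $B(\alpha_s,\alpha_t)=-\cos(\pi/m_{st})$ if the order $m_{st}$ of $st$ is finite and $B(\alpha_s,\alpha_t)\le -1$ if $m_{st}=\infty$. $W$ acts faithfully on $V$ by $s(v)=v-2B(\alpha_s,v)\alpha_s$. $\Phi=W(\Delta)$ is the root system, $\Phi^+=\Phi\cap\operatorname{cone}(\Delta)$.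 For $t\in T$, $\alpha_t\in\Phi^+$ is the unique positive root whose associated reflection is $t$. The depth of $\beta\in\Phi^+$ is $\operatorname{dp}(\beta)=\min\{\ell(w)\mid w\in W,\ w(\beta)\in\Delta\}$. The root poset $(\Phi^+,\le)$: $\alpha\le\beta$ iff there is $w\in W$ with $w(\alpha)=\beta$ and $\ell(w)=\operatorname{dp}(\beta)-\operatorname{dp}(\alpha)$. It is graded by $\operatorname{dp}$; $\lhd$ denotes the cover relation. For $t\in T$, a $t$-prefix is an element $p\in W$, $p\neq e$, such that for any reduced word $p=s_1\cdots s_{k+1}$ the word $s_1\cdots s_ks_{k+1}s_k\cdots s_1$ is a (palindromic) reduced word for $t$. A $t$-prefix has exactly one right descent. *)

theory Defs
  imports "HOL-Algebra.Algebra" "HOL-Analysis.Analysis"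
begin

section \<open>Coxeter systems\<close>

definition word_prod :: "('g, 'b) monoid_scheme \<Rightarrow> 'g list \<Rightarrow> 'g" where
  "word_prod W ws = foldr (\<otimes>\<^bsub>W\<^esub>) ws \<one>\<^bsub>W\<^esub>"

text \<open>\<^const>\<open>group.ord\<close> is 0 exactly for elements of infinite order, so \<open>cox_m W s t = 0\<close>
  encodes \<open>m\<^sub>s\<^sub>t = \<infinity>\<close>.\<close>

definition cox_m :: "('g, 'b) monoid_scheme \<Rightarrow> 'g \<Rightarrow> 'g \<Rightarrow> nat" where
  "cox_m W s t = group.ord W (s \<otimes>\<^bsub>W\<^esub> t)"

text \<open>The congruence on the free monoid over \<open>S\<close> generated by the relations
  \<open>(st)\<^sup>m = 1\<close> for all \<open>s, t \<in> S\<close> with \<open>m = m\<^sub>s\<^sub>t < \<infinity>\<close>. For an involution \<open>s\<close> the case \<open>s = t\<close>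
  (with \<open>m = 1\<close>) is the relation \<open>ss = 1\<close>; hence every letter is its own inverse modulo
  the congruence and the quotient is the group presented by these relations.\<close>

inductive cox_cong :: "('g, 'b) monoid_scheme \<Rightarrow> 'g set \<Rightarrow> 'g list \<Rightarrow> 'g list \<Rightarrow> bool"
  for W S where
  rel: "\<lbrakk>us \<in> lists S; vs \<in> lists S; s \<in> S; t \<in> S; cox_m W s t \<noteq> 0\<rbrakk> \<Longrightarrow>
     cox_cong W S (us @ concat (replicate (cox_m W s t) [s, t]) @ vs) (us @ vs)"
| refl: "us \<in> lists S \<Longrightarrow> cox_cong W S us us"
| sym: "cox_cong W S us vs \<Longrightarrow> cox_cong W S vs us"
| trans: "\<lbrakk>cox_cong W S us vs; cox_cong W S vs ws\<rbrakk> \<Longrightarrow> cox_cong W S us ws"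

locale coxeter_system = group W for W :: "('g, 'b) monoid_scheme" (structure) +
  fixes S :: "'g set"
  assumes finite_gens: "finite S"
    and gens_closed: "S \<subseteq> carrier W"
    and gens_order: "\<And>s. s \<in> S \<Longrightarrow> group.ord W s = 2"
    and gens_generate: "generate W S = carrier W"
    and presentation: "\<And>us vs. \<lbrakk>us \<in> lists S; vs \<in> lists S; word_prod W us = word_prod W vs\<rbrakk>
      \<Longrightarrow> cox_cong W S us vs"

definition cox_length :: "('g, 'b) monoid_scheme \<Rightarrow> 'g set \<Rightarrow> 'g \<Rightarrow> nat" where
  "cox_length W S w = (LEAST n. \<exists>ws \<in> lists S. word_prod W ws = w \<and> length ws = n)"

definition reduced_word :: "('g, 'b) monoid_scheme \<Rightarrow> 'g set \<Rightarrow> 'g list \<Rightarrow> 'g \<Rightarrow> bool" where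
  "reduced_word W S ws w \<longleftrightarrow>
     ws \<in> lists S \<and> word_prod W ws = w \<and> length ws = cox_length W S w"

definition reflections :: "('g, 'b) monoid_scheme \<Rightarrow> 'g set \<Rightarrow> 'g set" where
  "reflections W S = {w \<otimes>\<^bsub>W\<^esub> s \<otimes>\<^bsub>W\<^esub> inv\<^bsub>W\<^esub> w | w s. w \<in> carrier W \<and> s \<in> S}"

definition right_descents :: "('g, 'b) monoid_scheme \<Rightarrow> 'g set \<Rightarrow> 'g \<Rightarrow> 'g set" where
  "right_descents W S w = {s \<in> S. cox_length W S (w \<otimes>\<^bsub>W\<^esub> s) < cox_length W S w}"

definition is_prefix_of :: "('g, 'b) monoid_scheme \<Rightarrow> 'g set \<Rightarrow> 'g \<Rightarrow> 'g \<Rightarrow> bool" where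
  "is_prefix_of W S t p \<longleftrightarrow> p \<in> carrier W \<and> p \<noteq> \<one>\<^bsub>W\<^esub> \<and>
     (\<forall>ws. reduced_word W S ws p \<longrightarrow> reduced_word W S (ws @ rev (butlast ws)) t)"


section \<open>Geometric representations and root systems\<close>

definition root_reflection :: "('v::real_vector \<Rightarrow> 'v \<Rightarrow> real) \<Rightarrow> 'v \<Rightarrow> 'v \<Rightarrow> 'v" where
  "root_reflection B \<beta> v = v - (2 * B \<beta> v) *\<^sub>R \<beta>"

text \<open>\<open>V\<close> is the whole type \<open>'v\<close>; \<open>\<alpha> s\<close> is the simple root \<open>\<alpha>\<^sub>s\<close> and
  \<open>act w v\<close> is \<open>w(v)\<close>.\<close>

locale geometric_representation = coxeter_system W S
  for W :: "('g, 'b) monoid_scheme" (structure) and S :: "'g set" +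
  fixes B :: "'v::real_vector \<Rightarrow> 'v \<Rightarrow> real"
    and \<alpha> :: "'g \<Rightarrow> 'v"
    and act :: "'g \<Rightarrow> 'v \<Rightarrow> 'v"
  assumes finite_dimensional: "\<exists>b :: 'v set. finite b \<and> span b = UNIV"
    and form_bilinear: "bilinear B"
    and form_symmetric: "\<And>u v. B u v = B v u"
    and simple_positively_independent:
      "\<And>a :: 'g \<Rightarrow> real. \<lbrakk>\<And>s. s \<in> S \<Longrightarrow> 0 \<le> a s; (\<Sum>s\<in>S. a s *\<^sub>R \<alpha> s) = 0\<rbrakk>
        \<Longrightarrow> \<forall>s\<in>S. a s = 0"
    and form_diag: "\<And>s. s \<in> S \<Longrightarrow> B (\<alpha> s) (\<alpha> s) = 1"
    and form_finite: "\<And>s t. \<lbrakk>s \<in> S; t \<in> S; s \<noteq> t; cox_m W s t \<noteq> 0\<rbrakk>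
        \<Longrightarrow> B (\<alpha> s) (\<alpha> t) = - cos (pi / real (cox_m W s t))"
    and form_infinite: "\<And>s t. \<lbrakk>s \<in> S; t \<in> S; s \<noteq> t; cox_m W s t = 0\<rbrakk>
        \<Longrightarrow> B (\<alpha> s) (\<alpha> t) \<le> - 1"
    and action_faithful: "faithful_action W UNIV act"
    and action_gens: "\<And>s v. s \<in> S \<Longrightarrow> act s v = root_reflection B (\<alpha> s) v"

definition root_system ::
  "('g, 'b) monoid_scheme \<Rightarrow> 'g set \<Rightarrow> ('g \<Rightarrow> 'v) \<Rightarrow> ('g \<Rightarrow> 'v \<Rightarrow> 'v) \<Rightarrow> 'v set" where
  "root_system W S \<alpha> act = {act w (\<alpha> s) | w s. w \<in> carrier W \<and> s \<in> S}"

definition simple_cone :: "'g set \<Rightarrow> ('g \<Rightarrow> 'v::real_vector) \<Rightarrow> 'v set" where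
  "simple_cone S \<alpha> = {\<Sum>s\<in>S. a s *\<^sub>R \<alpha> s | a :: 'g \<Rightarrow> real. \<forall>s\<in>S. 0 \<le> a s}"

definition pos_roots ::
  "('g, 'b) monoid_scheme \<Rightarrow> 'g set \<Rightarrow> ('g \<Rightarrow> 'v::real_vector) \<Rightarrow> ('g \<Rightarrow> 'v \<Rightarrow> 'v) \<Rightarrow> 'v set" where
  "pos_roots W S \<alpha> act = root_system W S \<alpha> act \<inter> simple_cone S \<alpha>"

text \<open>As \<open>W\<close> acts faithfully, an element of \<open>W\<close> is identified with the reflection of a root
  by comparing linear maps on \<open>V\<close>.\<close>

definition root_of_reflection ::
  "('g, 'b) monoid_scheme \<Rightarrow> 'g set \<Rightarrow> ('v::real_vector \<Rightarrow> 'v \<Rightarrow> real) \<Rightarrow> ('g \<Rightarrow> 'v)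
    \<Rightarrow> ('g \<Rightarrow> 'v \<Rightarrow> 'v) \<Rightarrow> 'g \<Rightarrow> 'v" where
  "root_of_reflection W S B \<alpha> act t =
     (THE \<beta>. \<beta> \<in> pos_roots W S \<alpha> act \<and> act t = root_reflection B \<beta>)"

definition depth ::
  "('g, 'b) monoid_scheme \<Rightarrow> 'g set \<Rightarrow> ('g \<Rightarrow> 'v) \<Rightarrow> ('g \<Rightarrow> 'v \<Rightarrow> 'v) \<Rightarrow> 'v \<Rightarrow> nat" where
  "depth W S \<alpha> act \<beta> =
     (LEAST n. \<exists>w \<in> carrier W. act w \<beta> \<in> \<alpha> ` S \<and> cox_length W S w = n)"


section \<open>The root poset\<close>

definition root_le ::
  "('g, 'b) monoid_scheme \<Rightarrow> 'g set \<Rightarrow> ('g \<Rightarrow> 'v::real_vector) \<Rightarrow> ('g \<Rightarrow> 'v \<Rightarrow> 'v)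
    \<Rightarrow> 'v \<Rightarrow> 'v \<Rightarrow> bool" where
  "root_le W S \<alpha> act \<beta> \<gamma> \<longleftrightarrow>
     \<beta> \<in> pos_roots W S \<alpha> act \<and> \<gamma> \<in> pos_roots W S \<alpha> act \<and>
     (\<exists>w \<in> carrier W. act w \<beta> = \<gamma> \<and>
        int (cox_length W S w) = int (depth W S \<alpha> act \<gamma>) - int (depth W S \<alpha> act \<beta>))"

definition root_covers ::
  "('g, 'b) monoid_scheme \<Rightarrow> 'g set \<Rightarrow> ('g \<Rightarrow> 'v::real_vector) \<Rightarrow> ('g \<Rightarrow> 'v \<Rightarrow> 'v)
    \<Rightarrow> 'v \<Rightarrow> 'v \<Rightarrow> bool" where
  "root_covers W S \<alpha> act \<beta> \<gamma> \<longleftrightarrow>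
     root_le W S \<alpha> act \<beta> \<gamma> \<and> \<beta> \<noteq> \<gamma> \<and>
     \<not> (\<exists>\<delta>. root_le W S \<alpha> act \<beta> \<delta> \<and> root_le W S \<alpha> act \<delta> \<gamma> \<and> \<delta> \<noteq> \<beta> \<and> \<delta> \<noteq> \<gamma>)"

definition saturated_chain ::
  "('g, 'b) monoid_scheme \<Rightarrow> 'g set \<Rightarrow> ('g \<Rightarrow> 'v::real_vector) \<Rightarrow> ('g \<Rightarrow> 'v \<Rightarrow> 'v)
    \<Rightarrow> 'v list \<Rightarrow> bool" where
  "saturated_chain W S \<alpha> act \<beta>s \<longleftrightarrow>
     \<beta>s \<noteq> [] \<and> set \<beta>s \<subseteq> pos_roots W S \<alpha> act \<and> successively (root_covers W S \<alpha> act) \<beta>s"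

text \<open>For \<open>ss = [s\<^sub>1, \<dots>, s\<^sub>k]\<close> this is the list
  \<open>[\<alpha>\<^sub>r, s\<^sub>k(\<alpha>\<^sub>r), s\<^sub>k\<^sub>-\<^sub>1s\<^sub>k(\<alpha>\<^sub>r), \<dots>, s\<^sub>1\<cdots>s\<^sub>k(\<alpha>\<^sub>r)]\<close> of length \<open>k + 1\<close>.\<close>

definition root_sequence ::
  "('g, 'b) monoid_scheme \<Rightarrow> ('g \<Rightarrow> 'v) \<Rightarrow> ('g \<Rightarrow> 'v \<Rightarrow> 'v) \<Rightarrow> 'g list \<Rightarrow> 'g \<Rightarrow> 'v list" where
  "root_sequence W \<alpha> act ss r =
     map (\<lambda>i. act (word_prod W (drop (length ss - i) ss)) (\<alpha> r)) [0..<Suc (length ss)]"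

end

theory Submission
  imports Defs
begin

text \<open>The key identity is \<open>\<ell>(t) = 2 dp(\<alpha>\<^sub>t) + 1\<close>. For \<open>w = s\<^sub>1 \<cdots> s\<^sub>k\<close> with \<open>w(\<alpha>\<^sub>r) = \<alpha>\<^sub>t\<close> one has
  \<open>t = w r w\<inverse>\<close>, a word of length \<open>2k + 1\<close>, and the depth increases by at most 1 along each step of
  the sequence of roots. So the word is reduced iff \<open>dp(\<alpha>\<^sub>t) = k\<close>, iff the sequence is a saturated
  chain of positive roots. In this case \<open>r\<close> is the only right descent of \<open>w r\<close>, so every reduced word
  of \<open>w r\<close> yields a palindrome for \<open>t\<close>.

  All of this rests on the fact that \<open>\<ell>(w s) > \<ell>(w)\<close> implies that \<open>w(\<alpha>\<^sub>s)\<close> is positive, which is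
  proved by splitting off from \<open>w\<close> the longest alternating suffix in \<open>s\<close> and a right descent \<open>t\<close>
  and reading the coefficients of its action on \<open>\<alpha>\<^sub>s\<close> as values of Chebyshev polynomials.\<close>

section \<open>Length in Coxeter systems\<close>

context coxeter_system
begin

abbreviation len :: "'g \<Rightarrow> nat" where "len \<equiv> cox_length W S"

lemma gen_carrier [simp]: "s \<in> S \<Longrightarrow> s \<in> carrier W"
  using gens_closed by blast

lemma gen_sq [simp]: "s \<in> S \<Longrightarrow> s \<otimes> s = \<one>"
  using pow_ord_eq_1[of s] gens_order[of s] by (simp add: numeral_2_eq_2)

lemma gen_inv [simp]: "s \<in> S \<Longrightarrow> inv s = s"
  using inv_equality[of s s] by simp

lemma gen_neq_one: "s \<in> S \<Longrightarrow> s \<noteq> \<one>"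
  using gens_order[of s] ord_eq_1[of \<one>] by auto

lemma gen_cancel [simp]:
  assumes "s \<in> S" "w \<in> carrier W"
  shows "w \<otimes> s \<otimes> s = w" and "s \<otimes> (s \<otimes> w) = w"
  using assms by (simp_all add: m_assoc flip: m_assoc[of s s])

lemma word_prod_Nil [simp]: "word_prod W [] = \<one>"
  and word_prod_Cons [simp]: "word_prod W (x # xs) = x \<otimes> word_prod W xs"
  by (simp_all add: word_prod_def)

lemma word_prod_closed [simp]: "ws \<in> lists S \<Longrightarrow> word_prod W ws \<in> carrier W"
  by (induction ws) auto

lemma word_prod_append:
  "us \<in> lists S \<Longrightarrow> vs \<in> lists S \<Longrightarrow> word_prod W (us @ vs) = word_prod W us \<otimes> word_prod W vs"
  by (induction us) (auto simp: m_assoc)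

lemma word_prod_rev: "ws \<in> lists S \<Longrightarrow> word_prod W (rev ws) = inv (word_prod W ws)"
proof (induction ws)
  case (Cons x xs)
  then have "x \<in> S" "rev xs \<in> lists S" "word_prod W (rev xs) = inv word_prod W xs"
    by auto
  then show ?case
    using Cons.prems word_prod_append[of "rev xs" "[x]"] by (simp add: inv_mult_group)
qed simp

lemma ex_word:
  assumes "w \<in> carrier W"
  shows "\<exists>ws\<in>lists S. word_prod W ws = w"
proof -
  have "w \<in> generate W S"
    using assms gens_generate by simp
  then show ?thesis
  proof (induction rule: generate.induct)
    case one
    show ?case by (rule bexI[of _ "[]"]) auto
  next
    case (incl h)
    then show ?case by (intro bexI[of _ "[h]"]) auto
  next
    case (inv h)
    then show ?case by (intro bexI[of _ "[h]"]) auto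
  next
    case (eng h1 h2)
    then obtain us vs where "us \<in> lists S" "word_prod W us = h1" "vs \<in> lists S" "word_prod W vs = h2"
      by blast
    then show ?case by (intro bexI[of _ "us @ vs"]) (auto simp: word_prod_append)
  qed
qed

lemma ex_reduced_word:
  assumes "w \<in> carrier W"
  shows "\<exists>ws. reduced_word W S ws w"
proof -
  have "\<exists>n. \<exists>ws \<in> lists S. word_prod W ws = w \<and> length ws = n"
    using ex_word[OF assms] by blast
  from LeastI_ex[OF this] show ?thesis
    unfolding reduced_word_def cox_length_def by blast
qed

lemma len_word_prod_le: "ws \<in> lists S \<Longrightarrow> len (word_prod W ws) \<le> length ws"
  unfolding cox_length_def by (rule Least_le) blast

lemma len_mult_le:
  assumes "x \<in> carrier W" "y \<in> carrier W"
  shows "len (x \<otimes> y) \<le> len x + len y"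
proof -
  obtain us vs where "reduced_word W S us x" "reduced_word W S vs y"
    using ex_reduced_word assms by blast
  then show ?thesis
    using len_word_prod_le[of "us @ vs"] by (auto simp: reduced_word_def word_prod_append)
qed

lemma len_one [simp]: "len \<one> = 0"
  using len_word_prod_le[of "[]"] by simp

lemma len_eq_0: "w \<in> carrier W \<Longrightarrow> len w = 0 \<Longrightarrow> w = \<one>"
  using ex_reduced_word[of w] by (auto simp: reduced_word_def)

lemma len_gen [simp]:
  assumes "s \<in> S"
  shows "len s = 1"
proof -
  have "len s \<le> 1"
    using len_word_prod_le[of "[s]"] assms by simp
  moreover have "len s \<noteq> 0"
    using len_eq_0[of s] gen_neq_one[of s] assms by auto
  ultimately show ?thesis by simp
qed

lemma len_inv [simp]:
  assumes "w \<in> carrier W"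
  shows "len (inv w) = len w"
proof -
  have *: "len (inv x) \<le> len x" if x: "x \<in> carrier W" for x
  proof -
    obtain ws where "reduced_word W S ws x"
      using ex_reduced_word x by blast
    then have ws: "ws \<in> lists S" "x = word_prod W ws" "len x = length ws"
      by (simp_all add: reduced_word_def)
    from ws(1) have "rev ws \<in> lists S" by auto
    from len_word_prod_le[OF this] word_prod_rev[OF ws(1)] ws show ?thesis by simp
  qed
  from *[of w] *[of "inv w"] assms show ?thesis by simp
qed

text \<open>The defining relations have even length, so the presentation yields the parity of the length
  without a determinant.\<close>

lemma even_length_cong: "cox_cong W S us vs \<Longrightarrow> even (length us) = even (length vs)"
proof (induction rule: cox_cong.induct)
  case (rel us vs s t)
  then show ?case by (simp add: length_concat sum_list_replicate)
qed auto

lemma even_len_word_prod: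
  assumes "ws \<in> lists S"
  shows "even (len (word_prod W ws)) = even (length ws)"
proof -
  obtain us where us: "reduced_word W S us (word_prod W ws)"
    using ex_reduced_word[OF word_prod_closed[OF assms]] by blast
  then have "us \<in> lists S" "word_prod W us = word_prod W ws" "length us = len (word_prod W ws)"
    by (simp_all only: reduced_word_def)
  with even_length_cong[OF presentation[of us ws]] assms show ?thesis by simp
qed

text \<open>Parity rules out equal lengths, and subadditivity bounds the change by 1.\<close>

lemma len_mult_gen:
  assumes "w \<in> carrier W" "s \<in> S"
  shows "len (w \<otimes> s) = Suc (len w) \<or> len w = Suc (len (w \<otimes> s))"
proof -
  obtain ws where ws: "reduced_word W S ws w"
    using ex_reduced_word assms by blast
  then have "even (len (w \<otimes> s)) = even (length (ws @ [s]))"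
    using even_len_word_prod[of "ws @ [s]"] assms by (auto simp: reduced_word_def word_prod_append)
  with ws have "even (len (w \<otimes> s)) \<noteq> even (len w)"
    by (auto simp: reduced_word_def)
  moreover have "len (w \<otimes> s) \<le> len w + 1"
    using len_mult_le[of w s] assms by simp
  moreover have "len w \<le> len (w \<otimes> s) + 1"
    using len_mult_le[of "w \<otimes> s" s] assms by simp
  ultimately show ?thesis by presburger
qed

lemma reduced_word_snocD:
  assumes "reduced_word W S (ws @ [s]) w"
  shows "s \<in> S" "reduced_word W S ws (w \<otimes> s)" "w = word_prod W ws \<otimes> s"
    "len w = Suc (len (w \<otimes> s))"
proof -
  from assms have *: "s \<in> S" "ws \<in> lists S" and len: "len w = Suc (length ws)"
    and prod: "w = word_prod W (ws @ [s])"
    by (simp_all add: reduced_word_def)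
  from prod * have prod: "w = word_prod W ws \<otimes> s"
    using word_prod_append[of ws "[s]"] by simp
  note * = * prod len
  then have ws: "w \<otimes> s = word_prod W ws" by simp
  then have "len (w \<otimes> s) \<le> length ws"
    using len_word_prod_le * by simp
  then have "len (w \<otimes> s) = length ws"
    using len_mult_gen[of w s] * by auto
  then show "s \<in> S" "reduced_word W S ws (w \<otimes> s)" "w = word_prod W ws \<otimes> s"
    "len w = Suc (len (w \<otimes> s))"
    using * ws by (auto simp: reduced_word_def)
qed

lemma reduced_word_appendD:
  assumes "reduced_word W S (us @ vs) w"
  shows "reduced_word W S vs (word_prod W vs)"
proof -
  from assms have *: "us \<in> lists S" "vs \<in> lists S" and len: "len w = length us + length vs"
    and prod: "w = word_prod W (us @ vs)"
    by (simp_all add: reduced_word_def)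
  note * = * len prod[unfolded word_prod_append[OF *]]
  then have "len w \<le> length us + len (word_prod W vs)"
    using len_mult_le[of "word_prod W us" "word_prod W vs"] len_word_prod_le[of us] by simp
  with * show ?thesis
    using len_word_prod_le[of vs] by (simp add: reduced_word_def)
qed

lemma ex_right_descent:
  assumes "w \<in> carrier W" "w \<noteq> \<one>"
  shows "\<exists>s\<in>S. len w = Suc (len (w \<otimes> s))"
proof -
  obtain ws where ws: "reduced_word W S ws w"
    using ex_reduced_word assms by blast
  with assms have "ws \<noteq> []" by (auto simp: reduced_word_def)
  then have "reduced_word W S (butlast ws @ [last ws]) w" using ws by simp
  then show ?thesis using reduced_word_snocD by blast
qed

text \<open>The product of the alternating word \<open>\<dots> t s t\<close> of \<open>n\<close> letters, which ends in \<open>t\<close> on the right.\<close>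

fun alt_prod :: "'g \<Rightarrow> 'g \<Rightarrow> nat \<Rightarrow> 'g" where
  "alt_prod s t 0 = \<one>"
| "alt_prod s t (Suc n) = (if even n then t else s) \<otimes> alt_prod s t n"

lemma alt_prod_closed [simp]: "s \<in> S \<Longrightarrow> t \<in> S \<Longrightarrow> alt_prod s t n \<in> carrier W"
  by (induction n) auto

lemma len_alt_prod: "s \<in> S \<Longrightarrow> t \<in> S \<Longrightarrow> len (alt_prod s t n) \<le> n"
proof (induction n)
  case (Suc n)
  then show ?case
    using len_mult_le[of s "alt_prod s t n"] len_mult_le[of t "alt_prod s t n"] by auto
qed simp

lemma alt_prod_even: "s \<in> S \<Longrightarrow> t \<in> S \<Longrightarrow> alt_prod s t (2 * n) = (s \<otimes> t) [^] n"
proof (induction n)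
  case (Suc n)
  then show ?case
    using nat_pow_Suc2[of "s \<otimes> t" n] by (simp add: m_assoc)
qed simp

text \<open>The word on the left alternates and has \<open>m + 2\<close> letters. The relation, of
  \<open>2 * (m + 1)\<close> letters, splits into such a word and an alternating word of
  \<open>m\<close> letters, which are therefore mutually inverse; reversing the latter gives the
  right-hand side.\<close>

lemma alt_prod_braid:
  assumes "s \<in> S" "t \<in> S" "cox_m W s t = Suc m"
  shows "alt_prod s t (Suc m) \<otimes> s = alt_prod s t m"
proof -
  have st: "s \<otimes> t \<in> carrier W" and ts: "t \<otimes> s \<in> carrier W" using assms by auto
  have inv: "inv (s \<otimes> t) = t \<otimes> s"
    using assms by (simp add: inv_mult_group)
  have pow: "(s \<otimes> t) [^] Suc m = \<one>"
    using pow_ord_eq_1[OF st] assms by (metis cox_m_def)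
  have flip: "t \<otimes> (s \<otimes> t) [^] k \<otimes> s = (t \<otimes> s) [^] Suc k" for k :: nat
  proof (induction k)
    case 0
    then show ?case using assms by simp
  next
    case (Suc k)
    have "t \<otimes> (s \<otimes> t) [^] Suc k \<otimes> s = (t \<otimes> (s \<otimes> t) [^] k \<otimes> s) \<otimes> (t \<otimes> s)"
      using assms by (simp add: m_assoc)
    then show ?case using Suc by simp
  qed
  \<comment> \<open>\<open>t \<otimes> s\<close> is the inverse of \<open>s \<otimes> t\<close>,
    whose powers with exponents \<open>k\<close> and \<open>l\<close> multiply to the
    identity.\<close>
  have inv_pow: "(t \<otimes> s) [^] k = (s \<otimes> t) [^] l" if "k + l = Suc m" for k l :: nat
  proof -
    have "(s \<otimes> t) [^] k \<otimes> (s \<otimes> t) [^] l = \<one>"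
      using pow that st by (simp add: nat_pow_mult)
    then show ?thesis
      using inv nat_pow_inv[OF st, of k] st by (metis inv_equality nat_pow_closed inv_comm inv_inv)
  qed
  show ?thesis
  proof (cases "even m")
    case True
    then obtain n where n: "m = 2 * n" by blast
    have "alt_prod s t (Suc m) \<otimes> s = (t \<otimes> s) [^] Suc n"
      using assms n flip[of n] alt_prod_even[of s t n] by simp
    also have "\<dots> = (s \<otimes> t) [^] n"
      using n by (intro inv_pow) simp
    also have "\<dots> = alt_prod s t m"
      using assms n alt_prod_even[of s t n] by simp
    finally show ?thesis .
  next
    case False
    then obtain n where n: "m = Suc (2 * n)" by (metis oddE Suc_eq_plus1)
    have "alt_prod s t (Suc m) \<otimes> s = (s \<otimes> t) [^] Suc n \<otimes> s"
      using assms n alt_prod_even[of s t "Suc n"] by simp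
    also have "\<dots> = (t \<otimes> s) [^] Suc n \<otimes> s"
      using n by (subst inv_pow[of "Suc n" "Suc n"]) auto
    also have "\<dots> = t \<otimes> (s \<otimes> t) [^] n \<otimes> s \<otimes> s"
      using flip[of n] by simp
    also have "\<dots> = alt_prod s t m"
      using assms n alt_prod_even[of s t n] by simp
    finally show ?thesis .
  qed
qed

text \<open>The braid relation settles \<open>n = cox_m W s t\<close>; each further letter on the
  left lengthens the product by at most 1.\<close>

lemma len_alt_prod_mult:
  assumes "s \<in> S" "t \<in> S" "cox_m W s t \<noteq> 0" "cox_m W s t \<le> n"
  shows "len (alt_prod s t n \<otimes> s) < n"
  using assms(4)
proof (induction rule: dec_induct)
  case base
  obtain m where "cox_m W s t = Suc m" using assms(3) not0_implies_Suc by blast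
  with assms show ?case
    using alt_prod_braid[of s t m] len_alt_prod[of s t m] by (simp del: alt_prod.simps)
next
  case (step n)
  have "len (a \<otimes> (alt_prod s t n \<otimes> s)) \<le> 1 + len (alt_prod s t n \<otimes> s)" if "a \<in> S" for a
    using len_mult_le[of a "alt_prod s t n \<otimes> s"] assms that by simp
  from this[of s] this[of t] step assms show ?case by (auto simp: m_assoc)
qed

text \<open>Taking the alternating suffix as long as possible leaves a factor \<open>x\<close> with
  neither \<open>s\<close> nor \<open>t\<close> as a right descent, so an induction on length
  applies to \<open>x\<close> and both simple roots. The bound on \<open>n\<close> later keeps the
  Chebyshev coefficients nonnegative.\<close>

lemma maximal_alternating_suffix:
  assumes w: "w \<in> carrier W" and st: "s \<in> S" "t \<in> S"
    and ws: "len w < len (w \<otimes> s)" and wt: "len (w \<otimes> t) < len w"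
  obtains x n where "x \<in> carrier W" "w = x \<otimes> alt_prod s t n" "len x < len w"
    "len x < len (x \<otimes> s)" "len x < len (x \<otimes> t)" "cox_m W s t = 0 \<or> n < cox_m W s t"
proof -
  define P where "P n \<longleftrightarrow> (\<exists>x\<in>carrier W. w = x \<otimes> alt_prod s t n \<and> len w = len x + n)" for n
  \<comment> \<open>As \<open>t\<close> is a right descent of \<open>w\<close>, a suffix of one
    letter can be split off.\<close>
  have "P 1"
    unfolding P_def using w st wt len_mult_gen[of w t]
    by (intro bexI[of _ "w \<otimes> t"]) auto
  moreover have bound: "\<forall>n. P n \<longrightarrow> n \<le> len w"
    unfolding P_def by auto
  ultimately obtain n where Pn: "P n" and max: "\<And>k. P k \<Longrightarrow> k \<le> n" and n1: "1 \<le> n"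
    using Greatest_le_nat[of P _ "len w"] GreatestI_nat[of P 1 "len w"] by blast
  then obtain x where x: "x \<in> carrier W" "w = x \<otimes> alt_prod s t n" "len w = len x + n"
    unfolding P_def by blast
  obtain k where k: "n = Suc k" using n1 by (cases n) auto
  \<comment> \<open>\<open>a\<close> is the leftmost letter of the suffix, \<open>b\<close> the
    letter that would extend it to the left.\<close>
  define a b where "a = (if even k then t else s)" and "b = (if even k then s else t)"
  have ab: "a \<in> S" "b \<in> S" "{a, b} = {s, t}" using st by (auto simp: a_def b_def)
  have "w = x \<otimes> a \<otimes> alt_prod s t k"
    using x ab st k by (simp add: m_assoc a_def)
  then have "len w \<le> len (x \<otimes> a) + k"
    using len_mult_le[of "x \<otimes> a" "alt_prod s t k"] len_alt_prod[of s t k] x ab st by simp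
  then have xa: "len x < len (x \<otimes> a)" using x k by simp
  \<comment> \<open>If \<open>b\<close> were a right descent of \<open>x\<close>, it could be moved
    into the suffix, against maximality.\<close>
  have xb: "len x < len (x \<otimes> b)"
  proof (rule ccontr)
    assume "\<not> len x < len (x \<otimes> b)"
    then have "len x = Suc (len (x \<otimes> b))" using len_mult_gen[of x b] x ab by auto
    moreover have "w = (x \<otimes> b) \<otimes> alt_prod s t (Suc n)"
    proof -
      have "alt_prod s t (Suc n) = b \<otimes> alt_prod s t n"
        unfolding k b_def by simp
      then show ?thesis
        using x ab st by (simp add: m_assoc del: alt_prod.simps)
    qed
    ultimately have "P (Suc n)"
      unfolding P_def using x ab by (intro bexI[of _ "x \<otimes> b"]) auto
    then show False using max[of "Suc n"] by simp
  qed
  \<comment> \<open>A longer suffix would have length below \<open>n\<close> after multiplication by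
    \<open>s\<close>, making \<open>s\<close> a right descent of \<open>w\<close>.\<close>
  have "cox_m W s t = 0 \<or> n < cox_m W s t"
  proof (rule ccontr)
    assume "\<not> ?thesis"
    then have "len (alt_prod s t n \<otimes> s) < n"
      using len_alt_prod_mult[OF st] by simp
    then have "len (w \<otimes> s) < len w"
      using len_mult_le[of x "alt_prod s t n \<otimes> s"] x st by (simp add: m_assoc)
    with ws show False by simp
  qed
  moreover have "len x < len (x \<otimes> s)" "len x < len (x \<otimes> t)"
    using xa xb ab by (metis insertCI insertE singletonD)+
  ultimately show thesis using that[of x n] x n1 by simp
qed

end

section \<open>Positivity of roots\<close>

lemma cos_pi_div_nonneg: "2 \<le> m \<Longrightarrow> 0 \<le> cos (pi / real m)"
  by (intro cos_ge_zero) (auto simp: field_simps intro: order_trans[of _ 0])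

text \<open>The index is shifted: \<open>chebyshev_U c (n + 1)\<close> is \<open>U\<^sub>n(c / 2)\<close>.\<close>

fun chebyshev_U :: "real \<Rightarrow> nat \<Rightarrow> real" where
  "chebyshev_U c 0 = 0"
| "chebyshev_U c (Suc 0) = 1"
| "chebyshev_U c (Suc (Suc n)) = c * chebyshev_U c (Suc n) - chebyshev_U c n"

lemma chebyshev_U_sin: "chebyshev_U (2 * cos x) n * sin x = sin (real n * x)"
proof (induction n rule: chebyshev_U.induct[of _ undefined])
  case (3 c n)
  have "sin (real (Suc (Suc n)) * x) + sin (real n * x) = 2 * cos x * sin (real (Suc n) * x)"
    using sin_add[of "real (Suc n) * x" x] sin_diff[of "real (Suc n) * x" x]
    by (simp add: algebra_simps)
  with 3 show ?case by (simp add: algebra_simps)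
qed auto

text \<open>For \<open>x = pi / m\<close> and \<open>n \<le> m\<close> the angle
  \<open>n * x\<close> stays in \<open>[0, pi]\<close>, so the sine formula is a nonnegative number
  divided by a positive one.\<close>

lemma chebyshev_U_nonneg_finite:
  assumes "2 \<le> m" "n \<le> m"
  shows "0 \<le> chebyshev_U (2 * cos (pi / real m)) n"
proof -
  have "0 < sin (pi / real m)"
    using assms by (intro sin_gt_zero) (auto simp: field_simps)
  moreover have "0 \<le> sin (real n * (pi / real m))"
    using assms by (intro sin_ge_zero) (auto simp: field_simps)
  ultimately show ?thesis
    using chebyshev_U_sin[of "pi / real m" n] by (metis mult_less_0_iff not_le order_less_imp_le)
qed

text \<open>This serves infinite bonds. Nonnegativity alone does not pass through the recurrence, so
  monotonicity is carried along in the induction.\<close>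

lemma chebyshev_U_mono:
  assumes "2 \<le> c"
  shows "0 \<le> chebyshev_U c n \<and> chebyshev_U c n \<le> chebyshev_U c (Suc n)"
proof (induction n)
  case (Suc n)
  then have "2 * chebyshev_U c (Suc n) \<le> c * chebyshev_U c (Suc n)"
    using assms by (intro mult_right_mono) auto
  with Suc show ?case by auto
qed auto

context geometric_representation
begin

section \<open>Linearity of the action and invariance of the form\<close>

lemma act_one [simp]: "act \<one> v = v"
  using action_faithful group_action.id_eq_one[of W UNIV act]
  by (metis UNIV_I faithful_action_def restrict_apply')

lemma act_mult: "g \<in> carrier W \<Longrightarrow> h \<in> carrier W \<Longrightarrow> act (g \<otimes> h) v = act g (act h v)"
  using action_faithful group_action.composition_rule[of W UNIV act v g h]
  by (simp add: faithful_action_def)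

lemma act_inj: "g \<in> carrier W \<Longrightarrow> h \<in> carrier W \<Longrightarrow> (\<And>v. act g v = act h v) \<Longrightarrow> g = h"
  using faithful_action.faithful[OF action_faithful] by (auto dest: inj_onD)

lemma act_inv [simp]:
  assumes "g \<in> carrier W"
  shows "act (inv g) (act g v) = v" "act g (act (inv g) v) = v"
  using assms by (simp_all flip: act_mult)

lemma B_simps [simp]:
  "B (x + y) z = B x z + B y z" "B (x - y) z = B x z - B y z" "B (- x) z = - B x z"
  "B (c *\<^sub>R x) z = c * B x z"
  "B z (x + y) = B z x + B z y" "B z (x - y) = B z x - B z y" "B z (- x) = - B z x"
  "B z (c *\<^sub>R x) = c * B z x"
  "B 0 z = 0" "B z 0 = 0"
  using form_bilinear
  by (simp_all add: bilinear_ladd bilinear_lsub bilinear_lneg bilinear_lmul bilinear_radd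
      bilinear_rsub bilinear_rneg bilinear_rmul bilinear_lzero bilinear_rzero)

lemma act_gen_linear: "s \<in> S \<Longrightarrow> linear (act s)"
  by (rule linearI) (simp_all add: action_gens root_reflection_def algebra_simps)

lemma act_gen_isometry: "s \<in> S \<Longrightarrow> B (act s u) (act s v) = B u v"
  by (simp add: action_gens root_reflection_def form_diag algebra_simps form_symmetric[of u "\<alpha> s"])

lemma act_word_linear: "ws \<in> lists S \<Longrightarrow> linear (act (word_prod W ws))"
proof (induction ws)
  case Nil
  then show ?case by (simp add: linear_iff)
next
  case (Cons s ws)
  then have "linear (act s \<circ> act (word_prod W ws))"
    using act_gen_linear by (intro linear_compose) auto
  moreover have "act (word_prod W (s # ws)) = act s \<circ> act (word_prod W ws)"
    using Cons by (auto simp: act_mult fun_eq_iff)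
  ultimately show ?case by (simp only:)
qed

lemma act_linear: "w \<in> carrier W \<Longrightarrow> linear (act w)"
  using ex_word[of w] act_word_linear by blast

lemma act_word_isometry:
  "ws \<in> lists S \<Longrightarrow> B (act (word_prod W ws) u) (act (word_prod W ws) v) = B u v"
  by (induction ws) (auto simp: act_mult act_gen_isometry)

lemma act_isometry: "w \<in> carrier W \<Longrightarrow> B (act w u) (act w v) = B u v"
  using ex_word[of w] act_word_isometry by blast

lemma act_simple [simp]: "s \<in> S \<Longrightarrow> act s (\<alpha> s) = - \<alpha> s"
  by (simp add: action_gens root_reflection_def form_diag scaleR_2)

lemma act_conj_reflection:
  assumes w: "w \<in> carrier W" and x: "x \<in> carrier W" and refl: "\<And>v. act x v = root_reflection B \<beta> v"
  shows "act (w \<otimes> x \<otimes> inv w) v = root_reflection B (act w \<beta>) v"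
proof -
  have "B (act w \<beta>) v = B \<beta> (act (inv w) v)"
    using act_isometry[OF w, of \<beta> "act (inv w) v"] w by simp
  then show ?thesis
    using w x by (simp add: act_mult refl root_reflection_def linear_diff[OF act_linear]
        linear_cmul[OF act_linear])
qed

section \<open>The cone of the simple roots\<close>

abbreviation "pcone \<equiv> simple_cone S \<alpha>"

lemma cone_add:
  assumes "x \<in> pcone" "y \<in> pcone"
  shows "x + y \<in> pcone"
proof -
  from assms obtain a b where "\<forall>s\<in>S. 0 \<le> a s" "x = (\<Sum>s\<in>S. a s *\<^sub>R \<alpha> s)"
    "\<forall>s\<in>S. 0 \<le> b s" "y = (\<Sum>s\<in>S. b s *\<^sub>R \<alpha> s)"
    unfolding simple_cone_def by blast
  then show ?thesis
    unfolding simple_cone_def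
    by (auto intro!: exI[of _ "\<lambda>s. a s + b s"] simp: scaleR_add_left sum.distrib)
qed

lemma cone_scale:
  assumes "x \<in> pcone" "0 \<le> c"
  shows "c *\<^sub>R x \<in> pcone"
proof -
  from assms obtain a where "\<forall>s\<in>S. 0 \<le> a s" "x = (\<Sum>s\<in>S. a s *\<^sub>R \<alpha> s)"
    unfolding simple_cone_def by blast
  with assms show ?thesis
    unfolding simple_cone_def
    by (auto intro!: exI[of _ "\<lambda>s. c * a s"] simp: scaleR_sum_right)
qed

lemma simple_in_cone:
  assumes "s \<in> S"
  shows "\<alpha> s \<in> pcone"
proof -
  have "(\<Sum>u\<in>S. (if u = s then 1 else 0) *\<^sub>R \<alpha> u) = (\<Sum>u\<in>S. if u = s then \<alpha> u else 0)"
    by (intro sum.cong) auto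
  also have "\<dots> = \<alpha> s"
    using assms finite_gens by simp
  finally show ?thesis
    unfolding simple_cone_def by (auto intro!: exI[of _ "\<lambda>u. if u = s then 1 else 0"])
qed

text \<open>Adding the expansions of \<open>x\<close> and \<open>- x\<close> gives a vanishing
  combination with nonnegative coefficients, to which positive independence applies.\<close>

lemma cone_pointed:
  assumes "x \<in> pcone" "- x \<in> pcone"
  shows "x = 0"
proof -
  from assms obtain a b where ab: "\<forall>s\<in>S. 0 \<le> a s" "x = (\<Sum>s\<in>S. a s *\<^sub>R \<alpha> s)"
    "\<forall>s\<in>S. 0 \<le> b s" "- x = (\<Sum>s\<in>S. b s *\<^sub>R \<alpha> s)"
    unfolding simple_cone_def by blast
  have "(\<Sum>s\<in>S. (a s + b s) *\<^sub>R \<alpha> s) = x + - x"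
    unfolding ab(4) by (subst ab(2)) (simp add: scaleR_add_left sum.distrib)
  then have "(\<Sum>s\<in>S. (a s + b s) *\<^sub>R \<alpha> s) = 0" by simp
  with ab(1,3) have "\<forall>s\<in>S. a s + b s = 0"
    by (intro simple_positively_independent add_nonneg_nonneg) (auto simp only:)
  with ab(1,3) have "\<forall>s\<in>S. a s = 0"
    by (metis add_nonneg_eq_0_iff)
  then show ?thesis unfolding ab(2) by simp
qed

lemma cox_m_ge_2:
  assumes "s \<in> S" "t \<in> S" "s \<noteq> t" "cox_m W s t \<noteq> 0"
  shows "2 \<le> cox_m W s t"
proof -
  have "cox_m W s t \<noteq> 1"
  proof
    assume "cox_m W s t = 1"
    then have "s \<otimes> t = \<one>"
      using assms ord_eq_1[of "s \<otimes> t"] by (simp add: cox_m_def)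
    then have "inv t = s"
      using assms by (intro inv_equality) auto
    with assms show False by simp
  qed
  with assms show ?thesis by linarith
qed

lemma form_simple_nonpos:
  assumes "s \<in> S" "t \<in> S" "s \<noteq> t"
  shows "B (\<alpha> s) (\<alpha> t) \<le> 0"
proof (cases "cox_m W s t = 0")
  case True
  then show ?thesis using form_infinite[OF assms] by simp
next
  case False
  then show ?thesis
    using form_finite[OF assms] cos_pi_div_nonneg cox_m_ge_2[OF assms] by simp
qed

text \<open>Each reflection changes only the coefficient of its own simple root, and the new value
  is the next term of the Chebyshev recurrence.\<close>

lemma act_alt_prod:
  assumes "s \<in> S" "t \<in> S"
  defines "u \<equiv> chebyshev_U (- 2 * B (\<alpha> s) (\<alpha> t))"
  shows "act (alt_prod s t n) (\<alpha> s) = (if even n then u (Suc n) *\<^sub>R \<alpha> s + u n *\<^sub>R \<alpha> t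
    else u n *\<^sub>R \<alpha> s + u (Suc n) *\<^sub>R \<alpha> t)"
proof (induction n)
  case 0
  then show ?case by (simp add: u_def)
next
  case (Suc n)
  have rec: "u (Suc (Suc n)) = - 2 * B (\<alpha> s) (\<alpha> t) * u (Suc n) - u n"
    by (simp add: u_def)
  show ?case
    using Suc assms rec form_symmetric[of "\<alpha> t" "\<alpha> s"]
    by (simp add: act_mult action_gens root_reflection_def form_diag algebra_simps
        flip: scaleR_add_left)
qed

lemma act_simple_in_cone:
  assumes "w \<in> carrier W" "s \<in> S" "len w < len (w \<otimes> s)"
  shows "act w (\<alpha> s) \<in> pcone"
  using assms
proof (induction "len w" arbitrary: w s rule: less_induct)
  case less
  show ?case
  proof (cases "w = \<one>")
    case True
    with less show ?thesis by (simp add: simple_in_cone)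
  next
    case False
    then obtain t where t: "t \<in> S" "len w = Suc (len (w \<otimes> t))"
      using ex_right_descent less.prems by blast
    then have "s \<noteq> t" using less.prems by auto
    obtain x n where x: "x \<in> carrier W" "w = x \<otimes> alt_prod s t n" "len x < len w"
      "len x < len (x \<otimes> s)" "len x < len (x \<otimes> t)" and n: "cox_m W s t = 0 \<or> n < cox_m W s t"
      using maximal_alternating_suffix[of w s t] less.prems t by auto
    define u where "u = chebyshev_U (- 2 * B (\<alpha> s) (\<alpha> t))"
    \<comment> \<open>For a finite bond the strict bound on \<open>n\<close> is what admits the
      index \<open>Suc n\<close>.\<close>
    have u: "0 \<le> u n" "0 \<le> u (Suc n)"
    proof -
      have "0 \<le> u n \<and> 0 \<le> u (Suc n)"
      proof (cases "cox_m W s t = 0")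
        case True
        then have "2 \<le> - 2 * B (\<alpha> s) (\<alpha> t)"
          using form_infinite[OF less.prems(2) t(1) \<open>s \<noteq> t\<close>] by simp
        then show ?thesis
          unfolding u_def using chebyshev_U_mono order_trans by blast
      next
        case False
        then have "- 2 * B (\<alpha> s) (\<alpha> t) = 2 * cos (pi / real (cox_m W s t))"
          using form_finite[OF less.prems(2) t(1) \<open>s \<noteq> t\<close>] by simp
        then show ?thesis
          unfolding u_def
          using chebyshev_U_nonneg_finite cox_m_ge_2[OF less.prems(2) t(1) \<open>s \<noteq> t\<close> False] n False
          by (metis Suc_leI less_imp_le)
      qed
      then show "0 \<le> u n" "0 \<le> u (Suc n)" by auto
    qed
    \<comment> \<open>The induction hypothesis is used for the shorter \<open>x\<close> with both
      generators.\<close>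
    have "act x (\<alpha> s) \<in> pcone" "act x (\<alpha> t) \<in> pcone"
      using less.hyps[OF x(3) x(1)] x less.prems t by auto
    moreover have "act w (\<alpha> s) = (if even n then u (Suc n) *\<^sub>R act x (\<alpha> s) + u n *\<^sub>R act x (\<alpha> t)
      else u n *\<^sub>R act x (\<alpha> s) + u (Suc n) *\<^sub>R act x (\<alpha> t))"
      using x(1,2) less.prems t act_alt_prod[of s t n]
      by (simp add: act_mult u_def linear_add[OF act_linear] linear_cmul[OF act_linear])
    ultimately show ?thesis
      using u by (auto intro!: cone_add cone_scale)
  qed
qed

text \<open>The positive case applies to \<open>w \<otimes> s\<close>, and \<open>s\<close> negates
  its own simple root.\<close>

lemma act_simple_in_neg_cone:
  assumes "w \<in> carrier W" "s \<in> S" "len (w \<otimes> s) < len w"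
  shows "- act w (\<alpha> s) \<in> pcone"
proof -
  have "act (w \<otimes> s) (\<alpha> s) \<in> pcone"
    using assms by (intro act_simple_in_cone) auto
  then show ?thesis
    using assms by (simp add: act_mult linear_neg[OF act_linear])
qed

section \<open>Reflections and depth\<close>

abbreviation "\<Phi> \<equiv> root_system W S \<alpha> act"
abbreviation "\<Phi>p \<equiv> pos_roots W S \<alpha> act"
abbreviation "dp \<equiv> depth W S \<alpha> act"

lemma act_simple_root: "w \<in> carrier W \<Longrightarrow> s \<in> S \<Longrightarrow> act w (\<alpha> s) \<in> \<Phi>"
  unfolding root_system_def by blast

lemma act_root:
  assumes "w \<in> carrier W" "\<beta> \<in> \<Phi>"
  shows "act w \<beta> \<in> \<Phi>"
proof -
  obtain g s where g: "g \<in> carrier W" "s \<in> S" "\<beta> = act g (\<alpha> s)"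
    using assms(2) unfolding root_system_def by blast
  then have "act w \<beta> = act (w \<otimes> g) (\<alpha> s)"
    using assms by (simp add: act_mult)
  then show ?thesis
    using act_simple_root[of "w \<otimes> g" s] assms(1) g by simp
qed

lemma simple_pos_root: "s \<in> S \<Longrightarrow> \<alpha> s \<in> \<Phi>p"
  using act_simple_root[of \<one> s] simple_in_cone by (simp add: pos_roots_def)

lemma root_norm: "\<beta> \<in> \<Phi> \<Longrightarrow> B \<beta> \<beta> = 1"
  unfolding root_system_def by (auto simp: act_isometry form_diag)

lemma root_nonzero: "\<beta> \<in> \<Phi> \<Longrightarrow> \<beta> \<noteq> 0"
  using root_norm[of \<beta>] by auto

lemma root_cases:
  assumes "\<beta> \<in> \<Phi>"
  shows "\<beta> \<in> pcone \<or> - \<beta> \<in> pcone"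
proof -
  obtain g s where g: "g \<in> carrier W" "s \<in> S" "\<beta> = act g (\<alpha> s)"
    using assms unfolding root_system_def by blast
  then show ?thesis
    using act_simple_in_cone[of g s] act_simple_in_neg_cone[of g s] len_mult_gen[of g s] by auto
qed

text \<open>The simple roots need not be linearly independent, so the usual comparison of coefficients
  is not available: a simple root cannot lie in the cone of the others because the form is
  nonpositive between distinct simple roots.\<close>

lemma simple_root_of_act_neg:
  assumes "\<beta> \<in> pcone" "- act s \<beta> \<in> pcone" "s \<in> S" "\<beta> \<in> \<Phi>"
  shows "\<beta> = \<alpha> s"
proof -
  from assms(1) obtain a where a: "\<forall>s\<in>S. 0 \<le> a s" "\<beta> = (\<Sum>s\<in>S. a s *\<^sub>R \<alpha> s)"
    unfolding simple_cone_def by blast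
  from assms(2) obtain b where b: "\<forall>s\<in>S. 0 \<le> b s" "- act s \<beta> = (\<Sum>s\<in>S. b s *\<^sub>R \<alpha> s)"
    unfolding simple_cone_def by blast
  define c where "c = 2 * B (\<alpha> s) \<beta>"
  define d where "d u = a u + b u" for u
  define r where "r = (\<Sum>u\<in>S-{s}. d u *\<^sub>R \<alpha> u)"
  have d: "0 \<le> d u" if "u \<in> S" for u
    using a(1) b(1) that by (simp add: d_def)
  \<comment> \<open>Both summands lie in the cone, while their sum is a multiple of
    \<open>\<alpha> s\<close>.\<close>
  have "(\<Sum>u\<in>S. d u *\<^sub>R \<alpha> u) = \<beta> + - act s \<beta>"
    unfolding b(2) by (subst a(2)) (simp add: d_def scaleR_add_left sum.distrib)
  also have "\<dots> = c *\<^sub>R \<alpha> s"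
    using assms(3) by (simp add: action_gens root_reflection_def c_def)
  finally have "d s *\<^sub>R \<alpha> s + r = c *\<^sub>R \<alpha> s"
    using assms(3) finite_gens by (simp add: sum.remove[of S s] r_def)
  then have r: "r = (c - d s) *\<^sub>R \<alpha> s"
    by (simp add: algebra_simps)
  \<comment> \<open>Pairing with \<open>\<alpha> s\<close> determines the sign, since
    \<open>r\<close> involves only the other simple roots.\<close>
  have "c - d s = B r (\<alpha> s)"
    using assms(3) by (simp add: r form_diag)
  also have "\<dots> = (\<Sum>u\<in>S-{s}. d u * B (\<alpha> u) (\<alpha> s))"
    unfolding r_def using linear_sum[of "\<lambda>x. B x (\<alpha> s)" _ "S-{s}"] form_bilinear
    by (simp add: bilinear_def)
  also have "\<dots> \<le> 0"
    using d form_simple_nonpos assms(3) by (intro sum_nonpos mult_nonneg_nonpos) auto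
  finally have le: "c - d s \<le> 0" .
  \<comment> \<open>Moving the multiple of \<open>\<alpha> s\<close> to the other side gives a
    vanishing combination, with nonnegative coefficients by \<open>le\<close>.\<close>
  define f where "f u = (if u = s then d s - c else d u)" for u
  have "(\<Sum>u\<in>S-{s}. f u *\<^sub>R \<alpha> u) = r"
    unfolding r_def by (intro sum.cong) (auto simp: f_def)
  then have "(\<Sum>u\<in>S. f u *\<^sub>R \<alpha> u) = 0"
    using assms(3) finite_gens by (simp add: sum.remove[of S s] r f_def algebra_simps)
  moreover have "0 \<le> f u" if "u \<in> S" for u
    using d[OF that] le by (simp add: f_def)
  ultimately have "\<forall>u\<in>S. f u = 0"
    by (intro simple_positively_independent)
  then have "a u = 0" if "u \<in> S - {s}" for u
    using that a(1) b(1) by (auto simp: f_def d_def split: if_splits) (metis add_nonneg_eq_0_iff)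
  then have "(\<Sum>u\<in>S-{s}. a u *\<^sub>R \<alpha> u) = 0"
    by (intro sum.neutral) simp
  then have \<beta>: "\<beta> = a s *\<^sub>R \<alpha> s"
    unfolding a(2) using assms(3) finite_gens by (simp add: sum.remove[of S s])
  then have "(a s)\<^sup>2 = 1"
    using root_norm[OF assms(4)] assms(3) by (simp add: form_diag power2_eq_square)
  then have "a s = 1"
    using a(1) assms(3) power2_eq_1_iff[of "a s"] by fastforce
  with \<beta> show ?thesis by simp
qed

lemma pos_root_act_gen:
  assumes "\<beta> \<in> \<Phi>p" "s \<in> S" "\<beta> \<noteq> \<alpha> s"
  shows "act s \<beta> \<in> \<Phi>p"
  using assms simple_root_of_act_neg[of \<beta> s] root_cases[of "act s \<beta>"] act_root[of s \<beta>]
  by (auto simp: pos_roots_def)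

text \<open>Evaluating both reflections at \<open>\<beta>\<close> makes it a multiple of
  \<open>\<gamma>\<close>. As both have norm 1 the factor is 1 or -1, and the pointed cone excludes
  -1.\<close>

lemma root_reflection_inj:
  assumes "\<beta> \<in> \<Phi>p" "\<gamma> \<in> \<Phi>p" "root_reflection B \<beta> = root_reflection B \<gamma>"
  shows "\<beta> = \<gamma>"
proof -
  have norm: "B \<beta> \<beta> = 1" "B \<gamma> \<gamma> = 1"
    using assms root_norm by (auto simp: pos_roots_def)
  have "2 *\<^sub>R \<beta> = 2 *\<^sub>R (B \<gamma> \<beta> *\<^sub>R \<gamma>)"
    using fun_cong[OF assms(3), of \<beta>] norm by (simp add: root_reflection_def)
  then have eq: "\<beta> = B \<gamma> \<beta> *\<^sub>R \<gamma>"
    by (rule scaleR_left_imp_eq[rotated]) simp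
  then have "B \<beta> \<beta> = B \<gamma> \<beta> * B \<gamma> \<beta>"
    using B_simps(4)[of "B \<gamma> \<beta>" \<gamma> \<beta>] by simp
  then have "B \<gamma> \<beta> = 1 \<or> B \<gamma> \<beta> = - 1"
    using norm by (metis square_eq_1_iff)
  then show ?thesis
  proof
    assume "B \<gamma> \<beta> = - 1"
    with eq have "\<gamma> = - \<beta>" by simp
    then have "\<beta> = 0"
      using cone_pointed[of \<beta>] assms by (simp add: pos_roots_def)
    with norm show ?thesis by simp
  qed (use eq in simp)
qed

lemma act_conj_gen:
  "w \<in> carrier W \<Longrightarrow> s \<in> S \<Longrightarrow> act (w \<otimes> s \<otimes> inv w) = root_reflection B (act w (\<alpha> s))"
  using act_conj_reflection[of w s "\<alpha> s"] by (auto simp: action_gens)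

lemma ex_pos_root_of_reflection:
  assumes "t \<in> reflections W S"
  shows "\<exists>\<beta>\<in>\<Phi>p. act t = root_reflection B \<beta>"
proof -
  obtain w s where w: "w \<in> carrier W" "s \<in> S" "t = w \<otimes> s \<otimes> inv w"
    using assms unfolding reflections_def by blast
  have t: "act t = root_reflection B (act w (\<alpha> s))"
    using act_conj_gen w by simp
  have neg: "root_reflection B (- \<beta>) = root_reflection B \<beta>" for \<beta>
    by (simp add: root_reflection_def fun_eq_iff)
  have "act (w \<otimes> s) (\<alpha> s) = - act w (\<alpha> s)"
    using w by (simp add: act_mult linear_neg[OF act_linear])
  then have "- act w (\<alpha> s) \<in> \<Phi>"
    using act_simple_root[of "w \<otimes> s" s] w by simp
  then show ?thesis
    using root_cases[of "act w (\<alpha> s)"] act_simple_root[OF w(1,2)] t neg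
    unfolding pos_roots_def by (metis IntI)
qed

lemma root_of_reflection_eqI:
  assumes "\<beta> \<in> \<Phi>p" "act t = root_reflection B \<beta>"
  shows "root_of_reflection W S B \<alpha> act t = \<beta>"
  unfolding root_of_reflection_def using assms root_reflection_inj by (intro the_equality) auto

lemma depth_le: "w \<in> carrier W \<Longrightarrow> act w \<beta> \<in> \<alpha> ` S \<Longrightarrow> dp \<beta> \<le> len w"
  unfolding depth_def by (rule Least_le) blast

lemma ex_depth:
  assumes "\<beta> \<in> \<Phi>"
  shows "\<exists>w\<in>carrier W. act w \<beta> \<in> \<alpha> ` S \<and> len w = dp \<beta>"
proof -
  obtain g s where g: "g \<in> carrier W" "s \<in> S" "\<beta> = act g (\<alpha> s)"
    using assms unfolding root_system_def by blast
  then have "\<exists>n. \<exists>w\<in>carrier W. act w \<beta> \<in> \<alpha> ` S \<and> len w = n"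
    by (intro exI bexI[of _ "inv g"]) auto
  from LeastI_ex[OF this] show ?thesis unfolding depth_def .
qed

lemma depth_simple: "s \<in> S \<Longrightarrow> dp (\<alpha> s) = 0"
  using depth_le[of \<one> "\<alpha> s"] by simp

lemma depth_act_le:
  assumes "\<beta> \<in> \<Phi>" "w \<in> carrier W"
  shows "dp (act w \<beta>) \<le> dp \<beta> + len w"
proof -
  obtain x where x: "x \<in> carrier W" "act x \<beta> \<in> \<alpha> ` S" "len x = dp \<beta>"
    using ex_depth assms(1) by blast
  then have "dp (act w \<beta>) \<le> len (x \<otimes> inv w)"
    using assms by (intro depth_le) (auto simp: act_mult)
  also have "\<dots> \<le> dp \<beta> + len w"
    using len_mult_le[of x "inv w"] x assms by simp
  finally show ?thesis .
qed

text \<open>A shortest \<open>x\<close> taking \<open>\<beta>\<close> to a simple root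
  \<open>\<alpha> s\<close> gives \<open>t = inv x \<otimes> s \<otimes> x\<close> by
  faithfulness.\<close>

lemma len_reflection_le:
  assumes "t \<in> carrier W" "\<beta> \<in> \<Phi>" "act t = root_reflection B \<beta>"
  shows "len t \<le> 2 * dp \<beta> + 1"
proof -
  obtain x s where x: "x \<in> carrier W" "s \<in> S" "act x \<beta> = \<alpha> s" "len x = dp \<beta>"
    using ex_depth assms(2) by blast
  then have "act (inv x) (\<alpha> s) = \<beta>"
    using act_inv(1)[of x \<beta>] by simp
  then have "act (inv x \<otimes> s \<otimes> x) = root_reflection B \<beta>"
    using act_conj_gen[of "inv x" s] x by simp
  then have "t = inv x \<otimes> s \<otimes> x"
    using assms x by (intro act_inj) auto
  then show ?thesis
    using len_mult_le[of "inv x \<otimes> s" x] len_mult_le[of "inv x" s] x by simp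
qed

text \<open>If \<open>s\<close> is a right descent of \<open>t\<close>, then \<open>B \<beta> (\<alpha> s) > 0\<close>, so that conjugating \<open>t\<close> by \<open>s\<close>
  shortens it by 2 while the depth of its root drops by at most 1.\<close>

lemma len_reflection_ge:
  assumes "t \<in> carrier W" "\<beta> \<in> \<Phi>p" "act t = root_reflection B \<beta>"
  shows "2 * dp \<beta> + 1 \<le> len t"
  using assms
proof (induction "len t" arbitrary: t \<beta> rule: less_induct)
  case less
  have \<beta>: "\<beta> \<in> \<Phi>" "\<beta> \<in> pcone" "B \<beta> \<beta> = 1"
    using less.prems root_norm by (auto simp: pos_roots_def)
  have "act t \<beta> = - \<beta>"
    using less.prems(3) \<beta> by (simp add: root_reflection_def scaleR_2)
  then have "t \<noteq> \<one>"
    using root_nonzero[OF \<beta>(1)] cone_pointed[OF \<beta>(2)] \<beta>(2) by auto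
  show ?case
  proof (cases "\<beta> \<in> \<alpha> ` S")
    case True
    then show ?thesis
      using depth_simple len_eq_0[of t] less.prems(1) \<open>t \<noteq> \<one>\<close> by fastforce
  next
    case False
    have "t \<otimes> t = \<one>"
      using less.prems \<beta> by (intro act_inj) (auto simp: act_mult root_reflection_def algebra_simps)
    then have inv_t: "inv t = t"
      using less.prems(1) inv_equality by blast
    obtain s where s: "s \<in> S" "len t = Suc (len (t \<otimes> s))"
      using ex_right_descent less.prems(1) \<open>t \<noteq> \<one>\<close> by blast
    define b where "b = B \<beta> (\<alpha> s)"
    have act_t: "act t (\<alpha> s) = \<alpha> s - (2 * b) *\<^sub>R \<beta>"
      using less.prems(3) by (simp add: root_reflection_def b_def)
    have "- act t (\<alpha> s) \<in> pcone"
      using act_simple_in_neg_cone[of t s] less.prems(1) s by simp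
    have "0 < b"
    proof (rule ccontr)
      assume "\<not> 0 < b"
      then have "\<alpha> s + (- 2 * b) *\<^sub>R \<beta> \<in> pcone"
        using \<beta> s by (intro cone_add cone_scale simple_in_cone) auto
      then have "act t (\<alpha> s) = 0"
        using \<open>- act t (\<alpha> s) \<in> pcone\<close> act_t by (intro cone_pointed) auto
      then show False
        using root_nonzero act_simple_root less.prems(1) s by blast
    qed
    have s\<beta>: "act s \<beta> \<in> \<Phi>p"
      using pos_root_act_gen less.prems(2) s False by blast
    have len_st: "len (s \<otimes> t) = len (t \<otimes> s)"
    proof -
      have "inv (t \<otimes> s) = s \<otimes> t"
        using less.prems(1) s inv_t by (simp add: inv_mult_group)
      then show ?thesis
        using len_inv[of "t \<otimes> s"] less.prems(1) s by simp
    qed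
    \<comment> \<open>Since \<open>act s \<beta>\<close> is still positive, this shows that
      \<open>s\<close> is a right descent of \<open>s \<otimes> t\<close> too; hence conjugation
      loses two letters.\<close>
    have "- act (s \<otimes> t) (\<alpha> s) = \<alpha> s + (2 * b) *\<^sub>R act s \<beta>"
      using less.prems(1) s
      by (simp add: act_mult act_t linear_diff[OF act_linear] linear_cmul[OF act_linear])
    then have "- act (s \<otimes> t) (\<alpha> s) \<in> pcone"
      using s\<beta> s \<open>0 < b\<close> by (auto simp: pos_roots_def intro!: cone_add cone_scale simple_in_cone)
    moreover have "act (s \<otimes> t) (\<alpha> s) \<noteq> 0"
      using root_nonzero[OF act_simple_root[of "s \<otimes> t" s]] less.prems(1) s(1) by simp
    ultimately have "\<not> len (s \<otimes> t) < len (s \<otimes> t \<otimes> s)"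
      using act_simple_in_cone[of "s \<otimes> t" s] cone_pointed less.prems(1) s by auto
    then have len_sts: "len t = Suc (Suc (len (s \<otimes> t \<otimes> s)))"
      using len_mult_gen[of "s \<otimes> t" s] less.prems(1) s len_st by auto
    have "act (s \<otimes> t \<otimes> s) = root_reflection B (act s \<beta>)"
      using act_conj_reflection[of s t \<beta>] less.prems s by auto
    then have "2 * dp (act s \<beta>) + 1 \<le> len (s \<otimes> t \<otimes> s)"
      using less.hyps[of "s \<otimes> t \<otimes> s" "act s \<beta>"] len_sts s\<beta> less.prems(1) s by simp
    moreover have "act s (act s \<beta>) = \<beta>"
      using act_inv(2)[of s \<beta>] s(1) by simp
    then have "dp \<beta> \<le> dp (act s \<beta>) + 1"
      using depth_act_le[of "act s \<beta>" s] s\<beta> s(1) by (simp add: pos_roots_def)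
    ultimately show ?thesis using len_sts by simp
  qed
qed

lemma len_reflection:
  "t \<in> carrier W \<Longrightarrow> \<beta> \<in> \<Phi>p \<Longrightarrow> act t = root_reflection B \<beta> \<Longrightarrow> len t = 2 * dp \<beta> + 1"
  using len_reflection_ge[of t \<beta>] len_reflection_le[of t \<beta>] by (simp add: pos_roots_def)

text \<open>A second right descent \<open>u\<close> of \<open>w r\<close> would also be one of \<open>w\<close>, and
  \<open>w r w\<inverse> = (w u) (w r u)\<inverse>\<close> would be too short.\<close>

lemma unique_right_descent:
  assumes w: "w \<in> carrier W" and ru: "r \<in> S" "u \<in> S"
    and len: "len (w \<otimes> r \<otimes> inv w) = 2 * len w + 1"
    and desc: "len (w \<otimes> r \<otimes> u) < len (w \<otimes> r)"
  shows "u = r"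
proof (rule ccontr)
  assume "u \<noteq> r"
  have "len w < len (w \<otimes> r)"
    using len_mult_le[of "w \<otimes> r" "inv w"] len w ru by simp
  then have len_wr: "len (w \<otimes> r) = Suc (len w)"
    using len_mult_gen[of w r] w ru by auto
  then have "act w (\<alpha> r) \<in> pcone"
    using act_simple_in_cone w ru by simp
  moreover have "- act (w \<otimes> r) (\<alpha> u) \<in> pcone"
    using act_simple_in_neg_cone[of "w \<otimes> r" u] w ru desc by simp
  \<comment> \<open>The scalar is nonnegative because \<open>u\<close> and \<open>r\<close> are
    distinct, so both summands lie in the cone.\<close>
  moreover have "- act w (\<alpha> u) = - act (w \<otimes> r) (\<alpha> u) + (- 2 * B (\<alpha> r) (\<alpha> u)) *\<^sub>R act w (\<alpha> r)"
    using w ru by (simp add: act_mult action_gens root_reflection_def linear_diff[OF act_linear]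
        linear_cmul[OF act_linear])
  ultimately have "- act w (\<alpha> u) \<in> pcone"
    using form_simple_nonpos[of r u] ru \<open>u \<noteq> r\<close> by (metis cone_add cone_scale mult_nonpos_nonpos
        neg_le_0_iff_le zero_le_numeral)
  moreover have "act w (\<alpha> u) \<noteq> 0"
    using root_nonzero act_simple_root w ru by blast
  ultimately have "\<not> len w < len (w \<otimes> u)"
    using act_simple_in_cone[of w u] cone_pointed w ru by auto
  then have len_wu: "len w = Suc (len (w \<otimes> u))"
    using len_mult_gen[of w u] w ru by auto
  have "w \<otimes> r \<otimes> inv w = (w \<otimes> u) \<otimes> inv (w \<otimes> r \<otimes> u)"
    using w ru by (simp add: inv_mult_group m_assoc)
  then have "len (w \<otimes> r \<otimes> inv w) \<le> len (w \<otimes> u) + len (w \<otimes> r \<otimes> u)"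
    using len_mult_le[of "w \<otimes> u" "inv (w \<otimes> r \<otimes> u)"] w ru by simp
  with len len_wu len_wr desc show False by simp
qed

section \<open>Covers in the root poset and the sequence of roots\<close>

lemma root_le_depth:
  assumes "root_le W S \<alpha> act \<beta> \<gamma>" "\<beta> \<noteq> \<gamma>"
  shows "dp \<beta> < dp \<gamma>"
proof -
  obtain w where w: "w \<in> carrier W" "act w \<beta> = \<gamma>" "int (len w) = int (dp \<gamma>) - int (dp \<beta>)"
    using assms(1) unfolding root_le_def by blast
  then have "len w \<noteq> 0"
    using assms(2) len_eq_0[OF w(1)] act_one[of \<beta>] by metis
  with w(3) show ?thesis by linarith
qed

text \<open>Depth increases strictly along the order, so an intermediate root would have depth
  strictly between two consecutive integers.\<close>

lemma root_coversI:
  assumes "\<beta> \<in> \<Phi>p" "act s \<beta> \<in> \<Phi>p" "s \<in> S" "dp (act s \<beta>) = Suc (dp \<beta>)"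
  shows "root_covers W S \<alpha> act \<beta> (act s \<beta>)"
proof -
  have "root_le W S \<alpha> act \<beta> (act s \<beta>)"
    unfolding root_le_def using assms by (intro conjI bexI[of _ s]) auto
  moreover have "\<beta> \<noteq> act s \<beta>"
    using assms(4) by auto
  moreover have False if "root_le W S \<alpha> act \<beta> \<delta>" "root_le W S \<alpha> act \<delta> (act s \<beta>)"
    "\<delta> \<noteq> \<beta>" "\<delta> \<noteq> act s \<beta>" for \<delta>
    using root_le_depth[OF that(1)] root_le_depth[OF that(2)] that assms(4) by auto
  ultimately show ?thesis
    unfolding root_covers_def by blast
qed

lemma root_sequence_Nil: "root_sequence W \<alpha> act [] r = [\<alpha> r]"
  by (simp add: root_sequence_def)

text \<open>A letter put in front leaves the suffixes of \<open>ss\<close> unchanged, so only the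
  final root is new.\<close>

lemma root_sequence_Cons:
  "root_sequence W \<alpha> act (s # ss) r =
    root_sequence W \<alpha> act ss r @ [act (word_prod W (s # ss)) (\<alpha> r)]"
proof -
  have "map (\<lambda>i. act (word_prod W (drop (length (s # ss) - i) (s # ss))) (\<alpha> r)) [0..<Suc (length ss)]
    = root_sequence W \<alpha> act ss r"
    unfolding root_sequence_def by (intro map_cong) (auto simp: Suc_diff_le less_Suc_eq_le)
  then show ?thesis
    unfolding root_sequence_def by simp
qed

lemma root_sequence_last:
  "root_sequence W \<alpha> act ss r \<noteq> []"
  "last (root_sequence W \<alpha> act ss r) = act (word_prod W ss) (\<alpha> r)"
  by (cases ss; simp add: root_sequence_Nil root_sequence_Cons)+

lemma chain_length_le_depth:
  assumes "successively (root_covers W S \<alpha> act) (root_sequence W \<alpha> act ss r)"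
  shows "length ss \<le> dp (act (word_prod W ss) (\<alpha> r))"
  using assms
proof (induction ss)
  case (Cons s ss)
  then have "root_covers W S \<alpha> act (act (word_prod W ss) (\<alpha> r)) (act (word_prod W (s # ss)) (\<alpha> r))"
    and IH: "length ss \<le> dp (act (word_prod W ss) (\<alpha> r))"
    by (simp_all add: root_sequence_Cons successively_append_iff root_sequence_last)
  then have "dp (act (word_prod W ss) (\<alpha> r)) < dp (act (word_prod W (s # ss)) (\<alpha> r))"
    by (intro root_le_depth) (auto simp: root_covers_def)
  with IH show ?case by simp
qed simp

lemma reduced_word_pos_root:
  assumes "reduced_word W S (ss @ [r]) p"
  shows "act (word_prod W ss) (\<alpha> r) \<in> \<Phi>p"
proof -
  from reduced_word_snocD[OF assms] have r: "r \<in> S" and ss: "ss \<in> lists S"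
    and p: "p = word_prod W ss \<otimes> r" "len p = Suc (len (p \<otimes> r))"
    by (auto simp: reduced_word_def)
  then have w: "word_prod W ss \<in> carrier W" by auto
  with r p have "len (word_prod W ss) < len (word_prod W ss \<otimes> r)" by simp
  then show ?thesis
    using act_simple_in_cone act_simple_root w r by (simp add: pos_roots_def)
qed

text \<open>Each letter raises the depth by at most 1, so a final depth of \<open>length ss\<close>
  forces every step to raise it by exactly 1. Suffixes of a reduced word are reduced, which makes
  all the roots positive.\<close>

lemma saturated_chain_root_sequence:
  assumes "reduced_word W S (ss @ [r]) p"
    and "dp (act (word_prod W ss) (\<alpha> r)) = length ss"
  shows "saturated_chain W S \<alpha> act (root_sequence W \<alpha> act ss r)"
  using assms
proof (induction ss arbitrary: p)
  case Nil
  then show ?case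
    using simple_pos_root[of r] by (simp add: saturated_chain_def root_sequence_Nil reduced_word_def)
next
  case (Cons s ss)
  define \<beta> where "\<beta> = act (word_prod W ss) (\<alpha> r)"
  have s: "s \<in> S" and ss: "ss \<in> lists S" and r: "r \<in> S"
    using Cons.prems(1) by (auto simp: reduced_word_def)
  have w: "word_prod W ss \<in> carrier W" using ss by (rule word_prod_closed)
  have s\<beta>: "act (word_prod W (s # ss)) (\<alpha> r) = act s \<beta>"
    using s w by (simp add: act_mult \<beta>_def)
  have red: "reduced_word W S (ss @ [r]) (word_prod W (ss @ [r]))"
    using reduced_word_appendD[of "[s]" "ss @ [r]"] Cons.prems(1) by simp
  then have \<beta>: "\<beta> \<in> \<Phi>p"
    unfolding \<beta>_def by (rule reduced_word_pos_root)
  have "dp \<beta> \<le> length ss"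
    using depth_act_le[of "\<alpha> r" "word_prod W ss"] len_word_prod_le[OF ss] depth_simple[OF r]
      simple_pos_root[OF r] w by (simp add: \<beta>_def pos_roots_def)
  moreover have "dp (act s \<beta>) \<le> dp \<beta> + 1"
    using depth_act_le[of \<beta> s] \<beta> s by (simp add: pos_roots_def)
  ultimately have dp: "dp \<beta> = length ss" "dp (act s \<beta>) = Suc (dp \<beta>)"
    using Cons.prems(2) s\<beta> by simp_all
  have "act s \<beta> \<in> \<Phi>p"
    using reduced_word_pos_root[OF Cons.prems(1)] s\<beta> by simp
  moreover from this have "root_covers W S \<alpha> act \<beta> (act s \<beta>)"
    using root_coversI \<beta> s dp by blast
  moreover have "saturated_chain W S \<alpha> act (root_sequence W \<alpha> act ss r)"
    using Cons.IH[OF red] dp by (simp add: \<beta>_def)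
  ultimately show ?case
    unfolding saturated_chain_def root_sequence_Cons s\<beta>
    by (simp add: successively_append_iff root_sequence_last \<beta>_def)
qed

section \<open>Palindromes, prefixes and saturated chains\<close>

lemma palindrome_prod:
  assumes "ss \<in> lists S" "r \<in> S"
  shows "word_prod W (ss @ r # rev ss) = word_prod W ss \<otimes> r \<otimes> inv (word_prod W ss)"
proof -
  have "rev ss \<in> lists S" using assms by auto
  then show ?thesis
    using assms word_prod_append[of ss "r # rev ss"] word_prod_rev[of ss] word_prod_closed[of ss]
    by (simp add: m_assoc del: word_prod_closed)
qed

lemma saturated_chain_imp_prefix:
  assumes t: "t \<in> reflections W S" and r: "r \<in> S" and ss: "ss \<in> lists S"
    and chain: "saturated_chain W S \<alpha> act (root_sequence W \<alpha> act ss r)"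
    and root: "act (word_prod W ss) (\<alpha> r) = root_of_reflection W S B \<alpha> act t"
  shows "is_prefix_of W S t (word_prod W ss \<otimes> r)"
    and "reduced_word W S (ss @ [r]) (word_prod W ss \<otimes> r)"
proof -
  define w where "w = word_prod W ss"
  have w: "w \<in> carrier W" using ss unfolding w_def by (rule word_prod_closed)
  obtain \<beta> where \<beta>: "\<beta> \<in> \<Phi>p" "act t = root_reflection B \<beta>"
    using ex_pos_root_of_reflection[OF t] by blast
  have w\<beta>: "act w (\<alpha> r) = \<beta>"
    using root root_of_reflection_eqI[OF \<beta>] by (simp add: w_def)
  have tc: "t \<in> carrier W"
    using t unfolding reflections_def by auto
  have t_eq: "t = w \<otimes> r \<otimes> inv w"
    using act_conj_gen[OF w r] \<beta>(2) w\<beta> tc w r by (intro act_inj) auto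
  have len_w: "len w \<le> length ss"
    unfolding w_def using len_word_prod_le ss by blast
  have "length ss \<le> dp \<beta>"
    using chain_length_le_depth[of ss r] chain w\<beta> by (simp add: saturated_chain_def w_def)
  then have "2 * length ss + 1 \<le> len t"
    using len_reflection[OF tc \<beta>] by simp
  moreover have t_le: "len t \<le> len (w \<otimes> r) + len w"
    using len_mult_le[of "w \<otimes> r" "inv w"] t_eq w r by simp
  moreover have wr_le: "len (w \<otimes> r) \<le> len w + 1"
    using len_mult_le[of w r] w r by simp
  \<comment> \<open>With \<open>k = length ss\<close>, the bounds \<open>2 * k + 1 \<le> len t \<le>
    len (w \<otimes> r) + len w \<le> 2 * len w + 1 \<le> 2 * k + 1\<close> are all
    equalities.\<close>
  ultimately have len: "len w = length ss" "len (w \<otimes> r) = Suc (length ss)"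
    "len t = 2 * length ss + 1"
    using len_w by auto
  have prod: "word_prod W (ss @ [r]) = w \<otimes> r"
    using word_prod_append[of ss "[r]"] ss r by (simp add: w_def)
  show "reduced_word W S (ss @ [r]) (word_prod W ss \<otimes> r)"
    using ss r len prod unfolding reduced_word_def w_def by auto
  \<comment> \<open>Any reduced word of \<open>w \<otimes> r\<close> also ends in \<open>r\<close>;
    what precedes is a reduced word of \<open>w\<close>, so its palindrome has the same product and
    length.\<close>
  have "reduced_word W S (ws @ rev (butlast ws)) t" if ws: "reduced_word W S ws (w \<otimes> r)" for ws
  proof -
    have "ws \<noteq> []"
      using ws len by (auto simp: reduced_word_def)
    then obtain vs u where vs: "ws = vs @ [u]"
      by (metis rev_exhaust)
    from reduced_word_snocD[OF ws[unfolded vs]] have u: "u \<in> S"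
      and red: "reduced_word W S vs (w \<otimes> r \<otimes> u)" and "len (w \<otimes> r) = Suc (len (w \<otimes> r \<otimes> u))"
      by auto
    then have "u = r"
      using unique_right_descent[of w r u] w r t_eq len by simp
    then have *: "vs \<in> lists S" "word_prod W vs = w" "length vs = length ss"
      using red w r len by (auto simp: reduced_word_def)
    then have "rev vs \<in> lists S" by auto
    with * palindrome_prod[of vs r] show ?thesis
      using r t_eq len(3) unfolding reduced_word_def vs \<open>u = r\<close> by auto
  qed
  moreover have "w \<otimes> r \<noteq> \<one>"
    using len by auto
  ultimately show "is_prefix_of W S t (word_prod W ss \<otimes> r)"
    using w r unfolding is_prefix_of_def w_def by auto
qed

text \<open>The reduced palindrome fixes \<open>len t = 2 * length ss + 1\<close>, so the length
  formula for reflections gives the final root depth \<open>length ss\<close>.\<close>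

lemma prefix_imp_saturated_chain:
  assumes prefix: "is_prefix_of W S t p" and red: "reduced_word W S (ss @ [r]) p"
  shows "saturated_chain W S \<alpha> act (root_sequence W \<alpha> act ss r)"
    and "act (word_prod W ss) (\<alpha> r) = root_of_reflection W S B \<alpha> act t"
proof -
  define w where "w = word_prod W ss"
  have ss: "ss \<in> lists S" and r: "r \<in> S"
    using red by (auto simp: reduced_word_def)
  have w: "w \<in> carrier W" using ss unfolding w_def by (rule word_prod_closed)
  have "reduced_word W S (ss @ r # rev ss) t"
    using prefix red unfolding is_prefix_of_def by fastforce
  then have t: "t = w \<otimes> r \<otimes> inv w" and len: "len t = 2 * length ss + 1"
    using palindrome_prod[OF ss r] by (auto simp: reduced_word_def w_def)
  have tc: "t \<in> carrier W" using t w r by simp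
  have \<beta>: "act w (\<alpha> r) \<in> \<Phi>p"
    using reduced_word_pos_root[OF red] by (simp add: w_def)
  have act_t: "act t = root_reflection B (act w (\<alpha> r))"
    using act_conj_gen[OF w r] t by simp
  show "act (word_prod W ss) (\<alpha> r) = root_of_reflection W S B \<alpha> act t"
    using root_of_reflection_eqI[OF \<beta> act_t] by (simp add: w_def)
  have "dp (act w (\<alpha> r)) = length ss"
    using len_reflection[OF tc \<beta> act_t] len by simp
  then show "saturated_chain W S \<alpha> act (root_sequence W \<alpha> act ss r)"
    using saturated_chain_root_sequence[OF red] by (simp add: w_def)
qed

end

theorem proposition3p10:
  fixes W :: "('g, 'b) monoid_scheme"
    and S :: "'g set"
    and B :: "'v::real_vector \<Rightarrow> 'v \<Rightarrow> real"
    and \<alpha> :: "'g \<Rightarrow> 'v"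
    and act :: "'g \<Rightarrow> 'v \<Rightarrow> 'v"
    and t :: 'g
  assumes "geometric_representation W S B \<alpha> act"
    and "t \<in> reflections W S"
  shows "(\<forall>r ss. r \<in> S \<and> ss \<in> lists S
            \<and> saturated_chain W S \<alpha> act (root_sequence W \<alpha> act ss r)
            \<and> act (word_prod W ss) (\<alpha> r) = root_of_reflection W S B \<alpha> act t
          \<longrightarrow> (\<exists>p. is_prefix_of W S t p \<and> reduced_word W S (ss @ [r]) p))
       \<and> (\<forall>p ss r. is_prefix_of W S t p
            \<and> reduced_word W S (ss @ [r]) p
            \<and> right_descents W S p = {r}
          \<longrightarrow> saturated_chain W S \<alpha> act (root_sequence W \<alpha> act ss r)
            \<and> act (word_prod W ss) (\<alpha> r) = root_of_reflection W S B \<alpha> act t)"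
proof -
  interpret geometric_representation W S B \<alpha> act by (rule assms(1))
  show ?thesis
    using saturated_chain_imp_prefix[OF assms(2)] prefix_imp_saturated_chain by blast
qed

end
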